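(* For almost all graphs $G$ with $n$ vertices, \[ \ell(G) \ge n - (2\log_2 n + 2\log_2\log_2 n). \] That is, the probability that the random graph $G(n,\tfrac12)$ satisfies this inequality tends to $1$ as $n \to \infty$.
   Context: For a finite alphabet $\Sigma$, a decoder is a set $D \subseteq \Sigma^2$ of ordered pairs. For a word $w = w(1)\cdots w(n)$ with letters in $\Sigma$, the letter graph $\Gamma_D(w)$ is the graph with vertex set $\{1,\dots,n\}$ and an edge between $i<j$ exactly when $(w(i),w(j)) \in D$. If $|\Sigma| = k$, $\Gamma_D(w)$ is a $k$-letter graph. The lettericity $\ell(G)$ is the least $k$ such that $G$ is isomorphic to a $k$-letter graph. $G(n,\tfrac12)$ is the random graph on $n$ labeled vertices in which each edge is present independently with probability $\tfrac12$. *)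

theory Defs
  imports "HOL-Probability.Probability"
begin

text \<open>A (simple, undirected) graph is a pair of a vertex set and a set of edges, each edge
  being a two-element set of vertices.\<close>

type_synonym 'a graph = "'a set \<times> 'a set set"

definition all_edges :: "'a set \<Rightarrow> 'a set set" where
  "all_edges V = {e. e \<subseteq> V \<and> card e = 2}"

definition graph_iso :: "'a graph \<Rightarrow> 'b graph \<Rightarrow> bool" where
  "graph_iso G H \<longleftrightarrow>
     (\<exists>f. bij_betw f (fst G) (fst H) \<and> (\<lambda>e. f ` e) ` snd G = snd H)"

text \<open>Words are lists, so the letter written $w(i)$ for positions $1, \dots, n$ is \<open>w ! (i - 1)\<close>.\<close>

definition letter_graph :: "('s \<times> 's) set \<Rightarrow> 's list \<Rightarrow> nat graph" where
  "letter_graph D w =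
     ({1..length w},
      {{i, j} | i j. 1 \<le> i \<and> i < j \<and> j \<le> length w \<and> (w ! (i - 1), w ! (j - 1)) \<in> D})"

text \<open>Only the size of the alphabet matters, so alphabets may be taken to be finite sets of
  natural numbers. A word need not use every letter of its alphabet.\<close>

definition is_letter_graph :: "nat \<Rightarrow> nat graph \<Rightarrow> bool" where
  "is_letter_graph k H \<longleftrightarrow>
     (\<exists>(S :: nat set) D w. finite S \<and> card S = k \<and> D \<subseteq> S \<times> S \<and> set w \<subseteq> S \<and>
        H = letter_graph D w)"

definition lettericity :: "'a graph \<Rightarrow> nat" where
  "lettericity G = (LEAST k. \<exists>H. is_letter_graph k H \<and> graph_iso G H)"

text \<open>The minimum is attained for every finite graph, so the \<open>LEAST\<close> above is meaningful.\<close>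

lemma letter_graph_exists:
  fixes G :: "'a graph"
  assumes "finite (fst G)" "snd G \<subseteq> all_edges (fst G)"
  shows "\<exists>H. is_letter_graph (card (fst G)) H \<and> graph_iso G H"
proof -
  define n where "n = card (fst G)"
  obtain f where f: "bij_betw f (fst G) {1..n}"
    using ex_bij_betw_finite_nat[OF assms(1)] assms(1)
    by (metis card_atLeastAtMost diff_Suc_1 finite_atLeastAtMost finite_same_card_bij n_def)
  define D where "D = {(i, j). i \<in> {1..n} \<and> j \<in> {1..n} \<and> {i, j} \<in> (\<lambda>e. f ` e) ` snd G}"
  define w where "w = [1..<Suc n]"
  have "is_letter_graph n (letter_graph D w)"
    unfolding is_letter_graph_def
    by (intro exI[of _ "{1..n}"] exI[of _ D] exI[of _ w]) (auto simp: D_def w_def)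
  moreover have w: "w ! (i - 1) = i" if "1 \<le> i" "i \<le> n" for i
    using that by (simp add: w_def del: upt_Suc)
  have len: "length w = n" by (simp add: w_def)
  have "graph_iso G (letter_graph D w)"
    unfolding graph_iso_def
  proof (intro exI[of _ f] conjI)
    show "bij_betw f (fst G) (fst (letter_graph D w))"
      using f by (simp add: letter_graph_def len)
    show "(\<lambda>e. f ` e) ` snd G = snd (letter_graph D w)"
    proof (intro equalityI subsetI)
      fix e assume e: "e \<in> (\<lambda>e. f ` e) ` snd G"
      then obtain e' where e': "e' \<in> snd G" "e = f ` e'" by blast
      have sub: "e' \<subseteq> fst G" "card e' = 2" using e' assms(2) by (auto simp: all_edges_def)
      have "inj_on f e'" using f sub(1) by (meson bij_betw_def inj_on_subset)
      hence "card e = 2" using sub e' by (simp add: card_image)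
      moreover have "e \<subseteq> {1..n}" using f sub(1) e' by (auto simp: bij_betw_def)
      ultimately obtain x y where "e = {x, y}" "x \<noteq> y" "x \<in> {1..n}" "y \<in> {1..n}"
        by (auto simp: card_2_iff)
      then obtain i j where ij: "e = {i, j}" "i < j" "i \<in> {1..n}" "j \<in> {1..n}"
        by (metis insert_commute linorder_neqE_nat)
      hence "(w ! (i - 1), w ! (j - 1)) \<in> D" using e w[of i] w[of j] by (simp add: D_def)
      thus "e \<in> snd (letter_graph D w)" using ij by (auto simp: letter_graph_def len)
    next
      fix e assume "e \<in> snd (letter_graph D w)"
      then obtain i j where ij: "e = {i, j}" "1 \<le> i" "i < j" "j \<le> n"
          "(w ! (i - 1), w ! (j - 1)) \<in> D"
        by (auto simp: letter_graph_def len)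
      have "w ! (i - 1) = i" "w ! (j - 1) = j" using ij w[of i] w[of j] by auto
      hence "(i, j) \<in> D" using ij(5) by metis
      thus "e \<in> (\<lambda>e. f ` e) ` snd G" using ij(1) by (simp add: D_def)
    qed
  qed
  ultimately show ?thesis unfolding n_def by blast
qed

definition random_graph :: "nat \<Rightarrow> real \<Rightarrow> nat graph pmf" where
  "random_graph n p =
     map_pmf (\<lambda>present. ({1..n}, {e \<in> all_edges {1..n}. present e}))
       (Pi_pmf (all_edges {1..n}) False (\<lambda>_. bernoulli_pmf p))"

end

theory Submission
  imports Defs "HOL-Real_Asymp.Real_Asymp"
begin

text \<open>
  If a word on \<open>n\<close> positions uses at most \<open>n - r\<close> letters, some \<open>r + t\<close> of its positions carry
  exactly \<open>t \<le> r\<close> letters. On these vertices the graph is determined by their order in the word,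
  the word itself and a decoder on \<open>t\<close> letters. Naming each letter by one of its positions leaves
  at most \<open>2 ^ (r + t) * t ^ r\<close> words, so a union bound gives probability at most
  \<open>2 ^ (r + t) * n ^ (r + t) * t ^ r * 2 ^ (t * t) / 2 ^ ((r + t) choose 2)\<close> for each \<open>t\<close>.
  Identifying words up to renaming of letters matters: with all \<open>t ^ (r + t)\<close> words
  the bound would fail for \<open>t\<close> close to \<open>r\<close>.
\<close>

section \<open>Selecting positions that carry few letters\<close>

text \<open>Remove points from \<open>A\<close> as long as the inequality survives. Where no further
  point can go, equality holds and every fibre of \<open>h\<close> has at least two points, so the
  number of values is at most half the number of points; with excess exactly \<open>r\<close>, that
  means at most \<open>r\<close> values.\<close>

lemma excess_subset:
  assumes "finite A" "card (h ` A) + r \<le> card A"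
  obtains W where "W \<subseteq> A" "card W = card (h ` W) + r" "card (h ` W) \<le> r"
proof -
  have "\<exists>W\<subseteq>A. card W = card (h ` W) + r \<and> card (h ` W) \<le> r"
    using assms
  proof (induction A rule: finite_psubset_induct)
    case (psubset A)
    note fin = psubset.hyps(1)
    show ?case
    proof (cases "\<exists>x\<in>A. card (h ` (A - {x})) + r \<le> card (A - {x})")
      case True
      then obtain x where "x \<in> A" "card (h ` (A - {x})) + r \<le> card (A - {x})" by blast
      then show ?thesis using psubset.IH[of "A - {x}"] by blast
    next
      case False
      \<comment> \<open>Removing the only point of a fibre would lower both cardinalities by one and
        keep the inequality, contrary to the case assumption.\<close>
      have same: "h ` (A - {x}) = h ` A" if x: "x \<in> A" for x
      proof (rule ccontr)
        assume "h ` (A - {x}) \<noteq> h ` A"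
        then have "h ` (A - {x}) \<subset> h ` A" by blast
        then have "card (h ` (A - {x})) < card (h ` A)" using fin by (simp add: psubset_card_mono)
        then have "card (h ` (A - {x})) + r \<le> card (A - {x})" using psubset.prems x fin by simp
        with False x show False by blast
      qed
      have eq: "card A = card (h ` A) + r"
      proof (cases "A = {}")
        case True then show ?thesis using psubset.prems by simp
      next
        case nonempty: False
        then obtain x where x: "x \<in> A" by blast
        then have "\<not> card (h ` A) + r \<le> card A - 1" using False same[OF x] fin by auto
        then show ?thesis using psubset.prems by linarith
      qed
      \<comment> \<open>\<open>S\<close> takes one point from each fibre. A second point of each
        fibre lies outside \<open>S\<close>, so \<open>A - S\<close>, which has \<open>r\<close>
        elements, still maps onto all values.\<close>
      obtain S where S: "S \<subseteq> A" "inj_on h S" "h ` S = h ` A"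
        using subset_image_inj[of "h ` A" h A] by (metis order_refl)
      have "h ` A \<subseteq> h ` (A - S)"
      proof
        fix y assume "y \<in> h ` A"
        then obtain x where x: "x \<in> S" "y = h x" using S(3) by blast
        then have "y \<in> h ` (A - {x})" using same[of x] S(1) by blast
        then obtain x' where x': "x' \<in> A" "x' \<noteq> x" "h x' = h x" using x by (metis DiffE imageE insertI1)
        then have "x' \<notin> S" using S(2) x(1) by (meson inj_onD)
        then show "y \<in> h ` (A - S)" using x' x by (auto intro: rev_image_eqI[of x'])
      qed
      then have "card (h ` A) \<le> card (A - S)"
        using fin by (intro surj_card_le) auto
      also have "\<dots> = card A - card S"
        using S(1) fin by (simp add: card_Diff_subset finite_subset)
      also have "card S = card (h ` A)" using S(2,3) card_image by metis
      finally have "card (h ` A) \<le> r" using eq by simp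
      then show ?thesis using eq by blast
    qed
  qed
  then show ?thesis using that by blast
qed

section \<open>Prescribed edges in the random graph\<close>

lemma prob_random_graph_half_prescribed:
  assumes F: "F \<subseteq> all_edges {1..n}"
  shows "measure_pmf.prob (random_graph n (1/2)) {G. \<forall>e\<in>F. e \<in> snd G \<longleftrightarrow> c e} = (1/2) ^ card F"
proof -
  let ?A = "all_edges {1..n}"
  let ?P = "Pi_pmf ?A False (\<lambda>_. bernoulli_pmf (1/2))"
  let ?B = "\<lambda>e. if e \<in> F then {c e} else UNIV"
  have fin: "finite ?A" unfolding all_edges_def by (rule finite_subset[of _ "Pow {1..n}"]) auto
  have "measure_pmf.prob (random_graph n (1/2)) {G. \<forall>e\<in>F. e \<in> snd G \<longleftrightarrow> c e}
      = measure_pmf.prob ?P {f. \<forall>e\<in>F. f e \<longleftrightarrow> c e}"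
    unfolding random_graph_def using F by (auto simp: vimage_def intro!: arg_cong2[where f=measure])
  also have "\<dots> = measure_pmf.prob ?P (PiE_dflt ?A False ?B)"
  proof (rule measure_pmf.finite_measure_eq_AE)
    \<comment> \<open>\<open>PiE_dflt\<close> also demands the default \<open>False\<close> outside
      \<open>?A\<close>, so the two events agree only on the support.\<close>
    show "AE f in measure_pmf ?P. (f \<in> {f. \<forall>e\<in>F. f e \<longleftrightarrow> c e}) = (f \<in> PiE_dflt ?A False ?B)"
    proof (rule AE_pmfI)
      fix f assume "f \<in> set_pmf ?P"
      then have "f e = False" if "e \<notin> ?A" for e
        using that set_Pi_pmf_subset[OF fin, of False "\<lambda>_. bernoulli_pmf (1/2)"] by blast
      then show "(f \<in> {f. \<forall>e\<in>F. f e \<longleftrightarrow> c e}) = (f \<in> PiE_dflt ?A False ?B)"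
        using F by (auto simp: PiE_dflt_def split: if_splits)
    qed
  qed auto
  also have "\<dots> = (\<Prod>e\<in>?A. measure_pmf.prob (bernoulli_pmf (1/2)) (?B e))"
    by (rule measure_Pi_pmf_PiE_dflt[OF fin])
  also have "\<dots> = (\<Prod>e\<in>?A. if e \<in> F then 1/2 else 1)"
    by (intro prod.cong) (auto simp: measure_pmf_single)
  also have "\<dots> = (1/2) ^ card F"
    using fin F by (simp add: prod.If_cases Int_absorb1)
  finally show ?thesis .
qed

text \<open>Injectivity of \<open>v\<close> makes the edges of the pairs \<open>i < j\<close>
  distinct, so \<open>R\<close> fixes the outcome of \<open>N choose 2\<close> independent fair
  coins. \<open>R\<close> refers to the order of the indices, which is unrelated to the order of the
  vertex labels.\<close>

lemma prob_random_graph_half_induced: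
  assumes v: "inj_on v {..<N}" "v ` {..<N} \<subseteq> {1..n}"
  shows "measure_pmf.prob (random_graph n (1/2))
           {G. \<forall>j<N. \<forall>i<j. {v i, v j} \<in> snd G \<longleftrightarrow> R i j} = (1/2) ^ (N choose 2)"
proof -
  define P where "P = {(i, j). i < j \<and> j < N}"
  define f where "f = (\<lambda>(i, j). {v i, v j})"
  \<comment> \<open>\<open>R\<close> is not assumed symmetric, so an edge is first traced back to
    its index pair with \<open>i < j\<close>.\<close>
  define c where "c e = (case inv_into P f e of (i, j) \<Rightarrow> R i j)" for e
  have inj: "inj_on f P"
  proof (rule inj_onI)
    fix p q assume pq: "p \<in> P" "q \<in> P" "f p = f q"
    obtain i j k l where [simp]: "p = (i, j)" "q = (k, l)" by fastforce
    have lt: "i < j" "j < N" "k < l" "l < N" using pq by (auto simp: P_def)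
    have "v i = v k \<and> v j = v l \<or> v i = v l \<and> v j = v k"
      using pq(3) by (auto simp: f_def doubleton_eq_iff)
    then show "p = q"
      using inj_onD[OF v(1), of i k] inj_onD[OF v(1), of j l] inj_onD[OF v(1), of i l]
        inj_onD[OF v(1), of j k] lt by auto
  qed
  have F: "f ` P = {B. B \<subseteq> v ` {..<N} \<and> card B = 2}"
  proof (intro equalityI subsetI)
    fix e assume "e \<in> f ` P"
    then obtain i j where ij: "i < j" "j < N" "e = {v i, v j}" by (auto simp: P_def f_def)
    then have "v i \<noteq> v j" using inj_onD[OF v(1), of i j] by auto
    then show "e \<in> {B. B \<subseteq> v ` {..<N} \<and> card B = 2}" using ij by auto
  next
    fix e assume "e \<in> {B. B \<subseteq> v ` {..<N} \<and> card B = 2}"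
    then obtain i j where ij: "e = {v i, v j}" "i < N" "j < N" "v i \<noteq> v j"
      by (auto simp: card_2_iff)
    then consider "i < j" | "j < i" by (metis nat_neq_iff)
    then show "e \<in> f ` P"
    proof cases
      case 1 then show ?thesis using ij by (auto simp: P_def f_def intro!: rev_image_eqI[of "(i, j)"])
    next
      case 2 then show ?thesis using ij by (auto simp: P_def f_def intro!: rev_image_eqI[of "(j, i)"])
    qed
  qed
  have card: "card (f ` P) = N choose 2"
    unfolding F using n_subsets[of "v ` {..<N}" 2] v(1) by (simp add: card_image)
  have sub: "f ` P \<subseteq> all_edges {1..n}"
    unfolding F all_edges_def using v(2) by blast
  have "(\<forall>j<N. \<forall>i<j. {v i, v j} \<in> snd G \<longleftrightarrow> R i j) \<longleftrightarrow> (\<forall>e\<in>f ` P. e \<in> snd G \<longleftrightarrow> c e)"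
    for G :: "nat graph"
  proof -
    have "(\<forall>e\<in>f ` P. e \<in> snd G \<longleftrightarrow> c e) \<longleftrightarrow> (\<forall>p\<in>P. f p \<in> snd G \<longleftrightarrow> (case p of (i, j) \<Rightarrow> R i j))"
      using inj by (simp add: c_def)
    then show ?thesis by (auto simp: P_def f_def)
  qed
  then show ?thesis
    using prob_random_graph_half_prescribed[OF sub, of c] card by simp
qed

section \<open>Encoding low lettericity by a configuration\<close>

text \<open>These functions are words in normal form, each letter being named by a position in
  \<open>S\<close> that carries it. Only the positions outside \<open>S\<close> are free; for
  \<open>N = r + t\<close> and \<open>card S = t\<close> this gives the factor
  \<open>t ^ r\<close>.\<close>

lemma card_retractions:
  assumes "S \<subseteq> {..<N::nat}"
  shows "card (PiE {..<N} (\<lambda>i. if i \<in> S then {i} else S)) = card S ^ (N - card S)"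
proof -
  have fin: "finite S" using assms by (rule finite_subset) simp
  have "card (PiE {..<N} (\<lambda>i. if i \<in> S then {i} else S)) = (\<Prod>i<N. if i \<in> S then 1 else card S)"
    by (subst card_PiE) (auto intro!: prod.cong)
  also have "\<dots> = card S ^ card ({..<N} - S)"
    by (simp add: prod.If_cases Diff_eq)
  also have "card ({..<N} - S) = N - card S"
    using assms fin by (simp add: card_Diff_subset)
  finally show ?thesis .
qed

text \<open>This extracts the data that the union bound counts: \<open>v\<close> lists the selected
  vertices in word order, \<open>S\<close> holds one index per letter, \<open>w\<close> is the
  normalised word and \<open>D\<close> the decoder carried over to these names.\<close>

lemma letter_config:
  assumes G: "fst G = {1..n::nat}" "snd G \<subseteq> all_edges {1..n}"
    and r: "lettericity G + r \<le> n" "1 \<le> r"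
  obtains t S v w D where "1 \<le> t" "t \<le> r" "S \<subseteq> {..<r + t}" "card S = t"
    "v \<in> {..<r + t} \<rightarrow>\<^sub>E {1..n}" "inj_on v {..<r + t}"
    "w \<in> PiE {..<r + t} (\<lambda>i. if i \<in> S then {i} else S)" "D \<subseteq> S \<times> S"
    "\<forall>j<r + t. \<forall>i<j. {v i, v j} \<in> snd G \<longleftrightarrow> (w i, w j) \<in> D"
proof -
  have "\<exists>k H. is_letter_graph k H \<and> graph_iso G H"
    using letter_graph_exists[of G] G by auto
  then have "\<exists>H. is_letter_graph (lettericity G) H \<and> graph_iso G H"
    unfolding lettericity_def by (rule LeastI_ex)
  then obtain H where H: "is_letter_graph (lettericity G) H" "graph_iso G H" by blast
  obtain \<Sigma> :: "nat set" and D0 x where \<Sigma>: "finite \<Sigma>" "card \<Sigma> = lettericity G" "set x \<subseteq> \<Sigma>"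
    and Hx: "H = letter_graph D0 x"
    using H(1) unfolding is_letter_graph_def by blast
  obtain f where f: "bij_betw f (fst G) (fst H)" and E: "(\<lambda>e. f ` e) ` snd G = snd H"
    using H(2) unfolding graph_iso_def by blast
  have f: "bij_betw f {1..n} {1..length x}" using f G(1) by (simp add: Hx letter_graph_def)
  have len: "length x = n" using bij_betw_same_card[OF f] by simp
  define h where "h p = x ! (p - 1)" for p
  have "h ` {1..n} \<subseteq> \<Sigma>"
    using len by (auto simp: h_def intro!: subsetD[OF \<Sigma>(3)] nth_mem)
  then have "card (h ` {1..n}) \<le> lettericity G" using \<Sigma> by (metis card_mono)
  then obtain W where W: "W \<subseteq> {1..n}" "card W = card (h ` W) + r" "card (h ` W) \<le> r"
    using excess_subset[of "{1..n}" h r] r(1) by auto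
  have finW: "finite W" using W(1) by (rule finite_subset) simp
  define t where "t = card (h ` W)"
  \<comment> \<open>An increasing enumeration of \<open>W\<close>: index order has to agree with
    word order, since the decoder reads pairs from left to right.\<close>
  define e where "e i = sorted_list_of_set W ! i" for i
  have cW: "card W = r + t" using W(2) by (simp add: t_def)
  have "W \<noteq> {}" using cW r(2) by auto
  then have "1 \<le> t" using finW by (simp add: t_def Suc_le_eq card_gt_0_iff)
  have e: "bij_betw e {..<r + t} W"
    unfolding e_def using bij_betw_nth[of "sorted_list_of_set W" "{..<r + t}" W] finW cW by simp
  have mono: "e i < e j" if "i < j" "j < r + t" for i j
    unfolding e_def using that finW cW
    by (metis length_sorted_list_of_set sorted_wrt_nth_less strict_sorted_list_of_set)
  define u where "u i = h (e i)" for i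
  \<comment> \<open>\<open>rep\<close> selects for each letter one index that carries it; these
    indices become the new alphabet \<open>S\<close>.\<close>
  define rep where "rep = inv_into {..<r + t} u"
  define S where "S = rep ` u ` {..<r + t}"
  have u_img: "u ` {..<r + t} = h ` W"
    using e by (auto simp: u_def bij_betw_def image_image[symmetric])
  have u_rep: "u (rep y) = y" if "y \<in> u ` {..<r + t}" for y
    using that unfolding rep_def by (rule f_inv_into_f)
  have "inj_on rep (u ` {..<r + t})" unfolding rep_def by (rule inj_on_inv_into) simp
  then have "card S = card (u ` {..<r + t})" unfolding S_def by (rule card_image)
  then have cardS: "card S = t" by (simp only: u_img t_def[symmetric])
  have S: "S \<subseteq> {..<r + t}" unfolding S_def rep_def by (rule image_subsetI) (rule inv_into_into)
  have fix_S: "rep (u i) = i" if "i \<in> S" for i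
    using that u_rep by (auto simp: S_def)
  define w where "w = restrict (\<lambda>i. rep (u i)) {..<r + t}"
  have w: "w \<in> PiE {..<r + t} (\<lambda>i. if i \<in> S then {i} else S)"
    using fix_S by (auto simp: w_def S_def)
  define D where "D = {(a, b). a \<in> S \<and> b \<in> S \<and> (u a, u b) \<in> D0}"
  define g where "g = inv_into {1..n} f"
  define v where "v = restrict (\<lambda>i. g (e i)) {..<r + t}"
  have g: "bij_betw g {1..n} {1..n}" unfolding g_def using f len by (metis bij_betw_inv_into)
  have fg: "f (g p) = p" if "p \<in> {1..n}" for p
    unfolding g_def using that f len by (metis bij_betw_inv_into_right)
  have eW: "e i \<in> {1..n}" if "i < r + t" for i
    using that e W(1) by (auto simp: bij_betw_def)
  have vG: "v \<in> {..<r + t} \<rightarrow>\<^sub>E {1..n}"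
    using eW g by (auto simp: v_def bij_betw_def)
  have vinj: "inj_on v {..<r + t}"
  proof (rule inj_onI)
    fix i j assume ij: "i \<in> {..<r + t}" "j \<in> {..<r + t}" "v i = v j"
    then have "f (g (e i)) = f (g (e j))" by (simp add: v_def)
    then have "e i = e j" using ij eW fg by simp
    then show "i = j" using e ij by (meson bij_betw_def inj_onD)
  qed
  have adj: "{v i, v j} \<in> snd G \<longleftrightarrow> (w i, w j) \<in> D" if ij: "i < j" "j < r + t" for i j
  proof -
    have v_eq: "f ` {v i, v j} = {e i, e j}"
      using ij eW[of i] eW[of j] fg[of "e i"] fg[of "e j"] by (simp add: v_def)
    have vsub: "{v i, v j} \<subseteq> {1..n}"
      using PiE_mem[OF vG, of i] PiE_mem[OF vG, of j] ij by simp
    have "{v i, v j} \<in> snd G \<longleftrightarrow> f ` {v i, v j} \<in> (\<lambda>e. f ` e) ` snd G"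
    proof
      \<comment> \<open>Equal images give equal edges only because both lie in
        \<open>{1..n}\<close>, where \<open>f\<close> is injective.\<close>
      assume "f ` {v i, v j} \<in> (\<lambda>e. f ` e) ` snd G"
      then obtain e' where e': "e' \<in> snd G" "f ` {v i, v j} = f ` e'" by blast
      have "e' \<subseteq> {1..n}" using e'(1) G(2) by (auto simp: all_edges_def)
      then have "{v i, v j} = e'"
        using inj_on_image_eq_iff[of f "{1..n}" "{v i, v j}" e'] f vsub e'(2)
        by (simp add: bij_betw_def)
      then show "{v i, v j} \<in> snd G" using e' by simp
    qed blast
    also have "\<dots> \<longleftrightarrow> {e i, e j} \<in> snd (letter_graph D0 x)" using E v_eq Hx by simp
    also have "\<dots> \<longleftrightarrow> (u i, u j) \<in> D0"
      \<comment> \<open>The doubleton could match a decoder pair in either order;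
        \<open>e i < e j\<close> excludes the swapped match.\<close>
      using mono[OF ij] eW[of i] eW[of j] ij len
      by (auto simp: letter_graph_def u_def h_def doubleton_eq_iff)
    also have "\<dots> \<longleftrightarrow> (w i, w j) \<in> D"
      using ij u_rep[of "u i"] u_rep[of "u j"] by (auto simp: w_def D_def S_def)
    finally show ?thesis .
  qed
  show ?thesis
  proof (rule that[OF \<open>1 \<le> t\<close> _ S cardS vG vinj w])
    show "t \<le> r" using W(3) by (simp only: t_def)
    show "D \<subseteq> S \<times> S" by (auto simp: D_def)
    show "\<forall>j<r + t. \<forall>i<j. {v i, v j} \<in> snd G \<longleftrightarrow> (w i, w j) \<in> D" using adj by blast
  qed
qed

section \<open>Union bound over configurations\<close>

text \<open>In each summand, \<open>2 ^ (r + t)\<close> bounds the choices of \<open>S\<close>,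
  \<open>n ^ (r + t)\<close> those of \<open>v\<close>, \<open>t ^ r\<close> those of
  \<open>w\<close> and \<open>2 ^ (t * t)\<close> those of \<open>D\<close>. The denominator comes
  from the prescribed pairs.\<close>

lemma prob_lettericity_le:
  assumes r: "1 \<le> r"
  shows "measure_pmf.prob (random_graph n (1/2)) {G. lettericity G + r \<le> n}
    \<le> (\<Sum>t=1..r. real (2 ^ (r + t) * n ^ (r + t) * t ^ r * 2 ^ (t * t)) / 2 ^ ((r + t) choose 2))"
proof -
  let ?M = "random_graph n (1/2)"
  define Ss where "Ss t = {S. S \<subseteq> {..<r + t} \<and> card S = t}" for t
  define Q where "Q t S = ({..<r + t} \<rightarrow>\<^sub>E {1..n}) \<times>
    PiE {..<r + t} (\<lambda>i. if i \<in> S then {i} else S) \<times> Pow (S \<times> S)" for t and S :: "nat set"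
  define C where "C t = (\<Union>S\<in>Ss t. Q t S)" for t
  \<comment> \<open>Injectivity of \<open>v\<close> is part of the event, so \<open>C t\<close> may
    range over all maps \<open>v\<close>; those that are not injective contribute the empty
    event.\<close>
  define Ev :: "nat \<Rightarrow> (nat \<Rightarrow> nat) \<times> (nat \<Rightarrow> nat) \<times> (nat \<times> nat) set \<Rightarrow> nat graph set"
    where "Ev t = (\<lambda>(v, w, D). {G. inj_on v {..<r + t} \<and>
      (\<forall>j<r + t. \<forall>i<j. {v i, v j} \<in> snd G \<longleftrightarrow> (w i, w j) \<in> D)})" for t
  have finSs: "finite (Ss t)" for t
    unfolding Ss_def by (rule finite_subset[of _ "Pow {..<r + t}"]) auto
  have finS: "finite S" if "S \<in> Ss t" for S t
    using that finite_subset[of S "{..<r + t}"] by (auto simp: Ss_def)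
  have finC: "finite (C t)" for t
    unfolding C_def Q_def using finSs finS by (intro finite_UN_I finite_cartesian_product finite_PiE) auto
  have cardQ: "card (Q t S) = n ^ (r + t) * (t ^ r * 2 ^ (t * t))" if "S \<in> Ss t" for t S
    using that card_retractions[of S "r + t"] finS[OF that]
    by (simp add: Q_def Ss_def card_cartesian_product card_PiE card_Pow)
  have cardC: "card (C t) \<le> 2 ^ (r + t) * n ^ (r + t) * t ^ r * 2 ^ (t * t)" for t
  proof -
    have "card (C t) \<le> (\<Sum>S\<in>Ss t. card (Q t S))"
      unfolding C_def by (rule card_UN_le[OF finSs])
    also have "\<dots> = card (Ss t) * (n ^ (r + t) * (t ^ r * 2 ^ (t * t)))"
      using cardQ by simp
    also have "card (Ss t) \<le> 2 ^ (r + t)"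
      using card_mono[of "Pow {..<r + t}" "Ss t"] by (auto simp: Ss_def card_Pow)
    finally show ?thesis by (simp add: mult.assoc)
  qed
  have probE: "measure_pmf.prob ?M (Ev t c) \<le> 1 / 2 ^ ((r + t) choose 2)" if "c \<in> C t" for t c
  proof -
    obtain v w D where c: "c = (v, w, D)" by (cases c)
    have v: "v ` {..<r + t} \<subseteq> {1..n}" using that c by (auto simp: C_def Q_def)
    show ?thesis
    proof (cases "inj_on v {..<r + t}")
      case True
      then show ?thesis
        using prob_random_graph_half_induced[OF True v, of "\<lambda>i j. (w i, w j) \<in> D"]
        by (simp add: Ev_def c power_one_over)
    qed (simp add: Ev_def c)
  qed
  have "measure_pmf.prob ?M {G. lettericity G + r \<le> n}
      \<le> measure_pmf.prob ?M (\<Union>t\<in>{1..r}. \<Union>c\<in>C t. Ev t c)"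
  \<comment> \<open>The inclusion is needed only on the support, where \<open>G\<close> has vertex
    set \<open>{1..n}\<close> and \<open>letter_config\<close> applies.\<close>
  proof (rule measure_pmf.finite_measure_mono_AE)
    show "AE G in measure_pmf ?M. G \<in> {G. lettericity G + r \<le> n} \<longrightarrow>
        G \<in> (\<Union>t\<in>{1..r}. \<Union>c\<in>C t. Ev t c)"
    proof (rule AE_pmfI, rule impI)
      fix G assume "G \<in> set_pmf ?M" "G \<in> {G. lettericity G + r \<le> n}"
      then have G: "fst G = {1..n}" "snd G \<subseteq> all_edges {1..n}" "lettericity G + r \<le> n"
        by (auto simp: random_graph_def)
      obtain t S v w D where *: "1 \<le> t" "t \<le> r"
        "S \<subseteq> {..<r + t}" "card S = t"
        "v \<in> {..<r + t} \<rightarrow>\<^sub>E {1..n}" "inj_on v {..<r + t}"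
        "w \<in> PiE {..<r + t} (\<lambda>i. if i \<in> S then {i} else S)" "D \<subseteq> S \<times> S"
        "\<forall>j<r + t. \<forall>i<j. {v i, v j} \<in> snd G \<longleftrightarrow> (w i, w j) \<in> D"
        by (rule letter_config[OF G r])
      have "(v, w, D) \<in> Q t S" unfolding Q_def using * by blast
      moreover have "S \<in> Ss t" using * by (simp add: Ss_def)
      ultimately have "(v, w, D) \<in> C t" unfolding C_def by blast
      moreover have "G \<in> Ev t (v, w, D)" using * by (simp add: Ev_def)
      ultimately show "G \<in> (\<Union>t\<in>{1..r}. \<Union>c\<in>C t. Ev t c)" using *(1,2) by auto
    qed
  qed simp
  also have "\<dots> \<le> (\<Sum>t=1..r. measure_pmf.prob ?M (\<Union>c\<in>C t. Ev t c))"
    by (rule measure_pmf.finite_measure_subadditive_finite) auto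
  also have "\<dots> \<le> (\<Sum>t=1..r. \<Sum>c\<in>C t. measure_pmf.prob ?M (Ev t c))"
    by (intro sum_mono measure_pmf.finite_measure_subadditive_finite finC) auto
  also have "\<dots> \<le> (\<Sum>t=1..r. \<Sum>c\<in>C t. 1 / 2 ^ ((r + t) choose 2))"
    by (intro sum_mono probE)
  also have "\<dots> = (\<Sum>t=1..r. real (card (C t)) / 2 ^ ((r + t) choose 2))" by simp
  also have "\<dots> \<le> (\<Sum>t=1..r. real (2 ^ (r + t) * n ^ (r + t) * t ^ r * 2 ^ (t * t)) / 2 ^ ((r + t) choose 2))"
    using cardC by (intro sum_mono divide_right_mono of_nat_mono) auto
  finally show ?thesis .
qed

section \<open>Size of the union bound\<close>

text \<open>With \<open>L\<close> the logarithm of \<open>n\<close>, the left side is the binary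
  logarithm of a summand. Since \<open>L\<close> is at most \<open>r / 2 - log 2 L\<close>, the
  quadratic terms contribute at most \<open>(t * t - r * t) / 2\<close>, which vanishes at
  \<open>t = r\<close>. The gain must therefore come from \<open>(r + t) * log 2 L\<close>, set
  against \<open>r * log 2 t\<close>.\<close>

lemma exponent_bound:
  fixes L r t :: real
  assumes ll: "log 2 L \<ge> 400" and L: "L > 0"
    and r: "2 * L + 2 * log 2 L \<le> r" "r \<le> 3 * L" and t: "1 \<le> t" "t \<le> r"
  shows "(r + t) + (r + t) * L + r * log 2 t + t * t - (r + t) * (r + t - 1) / 2 \<le> - r"
proof -
  \<comment> \<open>The products are treated as atoms, with \<open>p\<close> for
    \<open>r * r\<close>, \<open>m\<close> for \<open>r * t\<close> and \<open>q\<close> for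
    \<open>t * t\<close>, so that the cancellation is linear.\<close>
  have aux: "s + x + c + q - y \<le> s * (3/2) - z + c"
    if "x \<le> (p + m) / 2 - z" "y = (p + 2 * m + q - s) / 2" "q \<le> m"
    for s x c q y z p m :: real
    using that by (simp add: field_simps)
  define l where "l = log 2 L"
  have r1: "r \<ge> 1" using t by linarith
  have 1: "(r + t) + (r + t) * L + r * log 2 t + t * t - (r + t) * (r + t - 1) / 2
      \<le> (r + t) * (3/2) - (r + t) * l + r * log 2 t"
  proof (rule aux[where p = "r * r" and m = "r * t"])
    have "(r + t) * L \<le> (r + t) * (r / 2 - l)"
      using r r1 t by (intro mult_left_mono) (auto simp: l_def)
    also have "\<dots> = (r * r + r * t) / 2 - (r + t) * l"
      by (simp add: algebra_simps add_divide_distrib)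
    finally show "(r + t) * L \<le> (r * r + r * t) / 2 - (r + t) * l" .
    show "t * t \<le> r * t" using t by (intro mult_right_mono) auto
  qed (simp add: algebra_simps)
  \<comment> \<open>The factor 3 is rounded up to 4 to make its logarithm an integer.\<close>
  have "log 2 r \<le> log 2 (4 * L)" using r r1 L by (subst log_le_cancel_iff) auto
  also have "\<dots> = 2 + l" using L log_pow_cancel[of 2 2] by (simp add: log_mult l_def)
  finally have lr: "log 2 r \<le> 2 + l" .
  have "r * (3/2) + t * (3/2) - (r * l + t * l) + r * log 2 t \<le> - r"
  \<comment> \<open>For small \<open>t\<close>, \<open>log 2 t\<close> is at most
    \<open>l - 4\<close>, which saves \<open>4 * r\<close>. For larger \<open>t\<close>, the term
    \<open>t * l\<close> is at least \<open>400 / 64 * r\<close>, that is \<open>6.25 * r\<close>,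
    which outweighs the remaining linear terms.\<close>
  proof (cases "t \<le> r / 64")
    case True
    have "log 2 t \<le> log 2 (r / 64)" using True r1 t by (subst log_le_cancel_iff) auto
    also have "\<dots> = log 2 r - 6" using r1 log_pow_cancel[of 2 6] by (simp add: log_divide)
    finally have "r * log 2 t \<le> r * (l - 4)" using lr r1 by (intro mult_left_mono) auto
    then have "r * log 2 t \<le> r * l - 4 * r" by (simp add: algebra_simps)
    moreover have "0 \<le> t * l" using t ll by (simp add: l_def)
    ultimately show ?thesis using t r1 by linarith
  next
    case False
    have "log 2 t \<le> log 2 r" using r1 t by (subst log_le_cancel_iff) auto
    then have "r * log 2 t \<le> r * (2 + l)" using lr r1 by (intro mult_left_mono) auto
    then have "r * log 2 t \<le> 2 * r + r * l" by (simp add: algebra_simps)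
    moreover have "r / 64 * 400 \<le> t * l" using False ll r1 by (intro mult_mono) (auto simp: l_def)
    ultimately show ?thesis using t r1 by linarith
  qed
  then have "(r + t) * (3/2) - (r + t) * l + r * log 2 t \<le> - r"
    by (simp only: distrib_right)
  with 1 show ?thesis by linarith
qed

text \<open>By \<open>exponent_bound\<close> each summand is at most 2 to the power
  \<open>- r\<close>, hence at most \<open>1 / real n ^ 2\<close> because \<open>r\<close> is at
  least twice the logarithm of \<open>n\<close>. There are \<open>r\<close> summands.\<close>

lemma union_bound_le:
  fixes n r :: nat
  assumes n: "n \<ge> 1" "log 2 (real n) > 0" "log 2 (log 2 (real n)) \<ge> 400"
    and r: "2 * log 2 (real n) + 2 * log 2 (log 2 (real n)) \<le> real r" "real r \<le> 3 * log 2 (real n)"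
  shows "(\<Sum>t=1..r. real (2 ^ (r + t) * n ^ (r + t) * t ^ r * 2 ^ (t * t)) / 2 ^ ((r + t) choose 2))
    \<le> 3 * log 2 (real n) / real n ^ 2"
proof -
  define L where "L = log 2 (real n)"
  have term_le: "real (2 ^ (r + t) * n ^ (r + t) * t ^ r * 2 ^ (t * t)) / 2 ^ ((r + t) choose 2)
      \<le> 1 / real n ^ 2" if t: "t \<in> {1..r}" for t
  proof -
    let ?x = "real (2 ^ (r + t) * n ^ (r + t) * t ^ r * 2 ^ (t * t)) / 2 ^ ((r + t) choose 2)"
    have "real ((r + t) choose 2) = real (r + t) * (real (r + t) - 1) / 2"
    proof -
      obtain m where "r + t = Suc m" using t by (cases "r + t") auto
      then show ?thesis by (simp add: choose_two real_of_nat_div del: of_nat_add mult_Suc mult_Suc_right)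
    qed
    then have "log 2 ?x = (real r + t) + (real r + t) * L + r * log 2 t + real t * real t
        - (real r + t) * (real r + t - 1) / 2"
      using n t by (simp add: log_mult log_divide log_nat_power L_def)
    also have "\<dots> \<le> - real r"
      using n r t by (intro exponent_bound) (auto simp: L_def)
    also have "\<dots> \<le> - (2 * L)" using n r by (simp add: L_def)
    also have "\<dots> = log 2 (1 / real n ^ 2)"
      using n by (simp add: L_def log_divide log_nat_power)
    finally show ?thesis
      using n t by (subst (asm) log_le_cancel_iff) auto
  qed
  have "(\<Sum>t=1..r. real (2 ^ (r + t) * n ^ (r + t) * t ^ r * 2 ^ (t * t)) / 2 ^ ((r + t) choose 2))
      \<le> (\<Sum>t=1..r. 1 / real n ^ 2)"
    by (intro sum_mono term_le)
  also have "\<dots> = real r / real n ^ 2" by simp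
  also have "\<dots> \<le> 3 * log 2 (real n) / real n ^ 2"
    using r by (intro divide_right_mono) auto
  finally show ?thesis .
qed

section \<open>Passage to the limit\<close>

theorem theorem6:
  shows "(\<lambda>n::nat. measure_pmf.prob (random_graph n (1/2))
            {G. real (lettericity G) \<ge>
                  real n - (2 * log 2 (real n) + 2 * log 2 (log 2 (real n)))})
         \<longlonglongrightarrow> 1"
proof -
  define b where "b n = 2 * log 2 (real n) + 2 * log 2 (log 2 (real n))" for n :: nat
  let ?good = "\<lambda>n. {G :: nat graph. real (lettericity G) \<ge> real n - b n}"
  \<comment> \<open>The summand 1 in \<open>b n + 1\<close> leaves room for rounding
    \<open>b n\<close> up to the integer \<open>r\<close>.\<close>
  have "\<forall>\<^sub>F n in sequentially. log 2 (log 2 (real n)) \<ge> 400 \<and> log 2 (real n) > 0 \<and>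
      b n + 1 \<le> 3 * log 2 (real n) \<and> n \<ge> 1"
    unfolding b_def by (intro eventually_conj) (real_asymp | rule eventually_ge_at_top)+
  then have lower: "\<forall>\<^sub>F n in sequentially.
      1 - 3 * log 2 (real n) / real n ^ 2 \<le> measure_pmf.prob (random_graph n (1/2)) (?good n)"
  proof eventually_elim
    case (elim n)
    define r where "r = nat \<lceil>b n\<rceil>"
    have "b n > 0" using elim by (simp add: b_def)
    then have r: "1 \<le> r" "b n \<le> real r" "real r \<le> b n + 1" unfolding r_def by linarith+
    have int_r: "int r = \<lceil>b n\<rceil>" using \<open>b n > 0\<close> by (simp add: r_def)
    have "- ?good n \<subseteq> {G. lettericity G + r \<le> n}"
    proof
      fix G :: "nat graph" assume "G \<in> - ?good n"
      then have "b n < real_of_int (int n - int (lettericity G))" by simp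
      \<comment> \<open>The difference is an integer exceeding \<open>b n\<close>, hence at least
        its ceiling; so rounding up loses nothing.\<close>
      then have "\<lceil>b n\<rceil> \<le> int n - int (lettericity G)" by (simp add: ceiling_le_iff del: of_int_diff)
      then show "G \<in> {G. lettericity G + r \<le> n}" using int_r by simp
    qed
    then have "measure_pmf.prob (random_graph n (1/2)) (- ?good n)
        \<le> measure_pmf.prob (random_graph n (1/2)) {G. lettericity G + r \<le> n}"
      by (intro measure_pmf.finite_measure_mono) auto
    also note prob_lettericity_le[OF r(1)]
    also have "(\<Sum>t=1..r. real (2 ^ (r + t) * n ^ (r + t) * t ^ r * 2 ^ (t * t)) / 2 ^ ((r + t) choose 2))
        \<le> 3 * log 2 (real n) / real n ^ 2"
    proof (rule union_bound_le)
      show "2 * log 2 (real n) + 2 * log 2 (log 2 (real n)) \<le> real r"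
        using r(2) by (simp only: b_def)
      show "real r \<le> 3 * log 2 (real n)" using r(3) elim by linarith
    qed (use elim in auto)
    finally show ?case
      using measure_pmf.prob_compl[of "?good n" "random_graph n (1/2)"] by (simp add: Compl_eq_Diff_UNIV)
  qed
  have lim: "(\<lambda>n::nat. 1 - 3 * log 2 (real n) / real n ^ 2) \<longlonglongrightarrow> 1"
    by real_asymp
  show ?thesis
    by (rule tendsto_sandwich[OF lower[unfolded b_def] _ lim tendsto_const]) simp
qed

end
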